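(* Let $A=(A_1,A_2)$ be a pair of real symmetric $n\times n$ matrices and let $B$ be a real symmetric positive semidefinite $n\times n$ matrix. Then the lower envelope $V_{A,B}:\mathbb{R}^2\to\mathbb{R}\cup\{+\infty\}$ is convex.
   Context: The lower envelope is defined by $$V_{A,B}(a)=\inf\bigl\{x^\top Bx\;\big|\;x\in\mathbb{R}^n,\ (x^\top A_1x,\,x^\top A_2x)=a\bigr\},\qquad\inf\varnothing=+\infty.$$ Convexity is meant in the extended-real-valued sense. *)

theory Defs
  imports "HOL-Analysis.Analysis"
begin

definition symmetric_matrix :: "real ^ 'n ^ 'n \<Rightarrow> bool" where
  "symmetric_matrix M \<longleftrightarrow> transpose M = M"

definition psd_matrix :: "real ^ 'n ^ 'n \<Rightarrow> bool" where
  "psd_matrix M \<longleftrightarrow> symmetric_matrix M \<and> (\<forall>x. 0 \<le> x \<bullet> (M *v x))"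

text \<open>
  The infimum is taken in \<^typ>\<open>ereal\<close>, where the infimum of the empty set is \<open>\<infinity>\<close>.
\<close>

definition lower_envelope ::
    "(real ^ 'n ^ 'n) \<times> (real ^ 'n ^ 'n) \<Rightarrow> real ^ 'n ^ 'n \<Rightarrow> real \<times> real \<Rightarrow> ereal" where
  "lower_envelope A B a =
     Inf {ereal (x \<bullet> (B *v x)) | x. (x \<bullet> (fst A *v x), x \<bullet> (snd A *v x)) = a}"

text \<open>
  The weights are strictly positive, so products of \<open>0\<close> and \<open>\<infinity>\<close> never occur. On
  \<^typ>\<open>ereal\<close> the sum of \<open>\<infinity>\<close> and \<open>-\<infinity>\<close> is \<open>\<infinity>\<close>, so this notion agrees with convexity
  of the epigraph also for functions that attain \<open>-\<infinity>\<close>.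
\<close>

definition ereal_convex :: "('a::real_vector \<Rightarrow> ereal) \<Rightarrow> bool" where
  "ereal_convex f \<longleftrightarrow>
     (\<forall>x y. \<forall>u>0. \<forall>v>0. u + v = 1 \<longrightarrow>
        f (u *\<^sub>R x + v *\<^sub>R y) \<le> ereal u * f x + ereal v * f y)"

end

theory Submission
  imports Defs
begin

text \<open>
  Restricting to the span of two witnesses \<open>x\<close>, \<open>y\<close> turns quadratic forms into linear functionals
  on symmetric \<open>2 \<times> 2\<close> matrices \<open>(p, r, q)\<close>, with points \<open>s x + t y\<close> corresponding to the matrices
  \<open>(s\<^sup>2, s t, t\<^sup>2)\<close>, that is, to the boundary of the positive semidefinite cone. A convex
  combination of the two values comes from the interior matrix \<open>(u, 0, v)\<close>. Two functionals on a
  three-dimensional space have a common kernel direction; following it, in the orientation that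
  does not increase \<open>B\<close>, leads to the boundary of the cone. The only obstruction would be a
  direction inside the cone, but there \<open>B\<close> is nonnegative, so the opposite orientation works.
\<close>

section \<open>Binary forms and the cone of positive semidefinite 2 x 2 matrices\<close>

lemma common_kernel_direction:
  fixes a1 b1 c1 a2 b2 c2 :: real
  obtains p r q where "(p, r, q) \<noteq> (0, 0, 0)"
    and "a1 * p + 2 * b1 * r + c1 * q = 0" and "a2 * p + 2 * b2 * r + c2 * q = 0"
proof -
  let ?S = "{(a1, 2 * b1, c1), (a2, 2 * b2, c2)}"
  have "dim ?S \<le> card ?S"
    by (rule dim_le_card') simp
  also have "\<dots> \<le> 2"
    by (simp add: card_insert_if)
  finally have "dim ?S < DIM(real \<times> real \<times> real)"
    by simp
  then obtain w where "w \<noteq> 0" and w: "\<And>y. y \<in> span ?S \<Longrightarrow> orthogonal w y"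
    using orthogonal_to_subspace_exists by metis
  obtain p r q where pqr: "w = (p, r, q)"
    by (cases w)
  show thesis
  proof
    show "(p, r, q) \<noteq> (0, 0, 0)"
      using \<open>w \<noteq> 0\<close> pqr by (simp add: zero_prod_def)
    show "a1 * p + 2 * b1 * r + c1 * q = 0"
      using w[of "(a1, 2 * b1, c1)"] pqr by (simp add: span_base orthogonal_def algebra_simps)
    show "a2 * p + 2 * b2 * r + c2 * q = 0"
      using w[of "(a2, 2 * b2, c2)"] pqr by (simp add: span_base orthogonal_def algebra_simps)
  qed
qed

text \<open>Self-duality of the cone: the pairing is the trace of a product of two positive
  semidefinite matrices.\<close>

lemma psd_pairing_nonneg:
  fixes \<alpha> \<beta> \<gamma> p q r :: real
  assumes form: "\<And>s t. 0 \<le> \<alpha> * s\<^sup>2 + 2 * \<beta> * (s * t) + \<gamma> * t\<^sup>2"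
    and "0 \<le> p" "0 \<le> q" "r\<^sup>2 \<le> p * q"
  shows "0 \<le> \<alpha> * p + 2 * \<beta> * r + \<gamma> * q"
proof -
  have \<gamma>: "0 \<le> \<gamma>"
    using form[of 0 1] by simp
  show ?thesis
  proof (cases "p = 0")
    case True
    with assms have "r = 0"
      by simp
    with True \<gamma> \<open>0 \<le> q\<close> show ?thesis
      by simp
  next
    case False
    with \<open>0 \<le> p\<close> have "0 < p"
      by simp
    \<comment> \<open>The form at \<open>(p, r)\<close> plus \<gamma> times the determinant of
      \<open>(p, r, q)\<close>; the sum contains the positive factor \<open>p\<close>.\<close>
    have "0 \<le> (\<alpha> * p\<^sup>2 + 2 * \<beta> * (p * r) + \<gamma> * r\<^sup>2) + \<gamma> * (p * q - r\<^sup>2)"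
      using \<gamma> assms by (intro add_nonneg_nonneg[OF form] mult_nonneg_nonneg) auto
    also have "\<dots> = p * (\<alpha> * p + 2 * \<beta> * r + \<gamma> * q)"
      by (simp add: algebra_simps power2_eq_square)
    finally show ?thesis
      using \<open>0 < p\<close> by (simp add: zero_le_mult_iff)
  qed
qed

text \<open>A singular positive semidefinite matrix has rank at most one; the sign of
  \<open>r\<close> is put into \<open>t\<close>.\<close>

lemma rank_one_factorization:
  fixes p q r :: real
  assumes "0 \<le> p" "0 \<le> q" "p * q = r\<^sup>2"
  obtains s t where "s\<^sup>2 = p" "t\<^sup>2 = q" "s * t = r"
proof
  let ?t = "if 0 \<le> r then sqrt q else - sqrt q"
  show "(sqrt p)\<^sup>2 = p" "?t\<^sup>2 = q"
    using assms by auto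
  have "sqrt p * sqrt q = \<bar>r\<bar>"
    using assms by (simp flip: real_sqrt_mult)
  then show "sqrt p * ?t = r"
    by auto
qed

text \<open>Intermediate value theorem for the smallest eigenvalue: diag(u, v) is positive definite,
  while at \<open>T\<close> the determinant is at most 0.\<close>

lemma segment_reaches_psd_boundary:
  fixes u v p q r T :: real
  assumes "0 < u" "0 < v" "0 \<le> T"
    and T: "(u + T * p) * (v + T * q) \<le> (T * r)\<^sup>2"
  obtains \<tau> where "0 \<le> \<tau>" "0 \<le> u + \<tau> * p" "0 \<le> v + \<tau> * q"
    "(u + \<tau> * p) * (v + \<tau> * q) = (\<tau> * r)\<^sup>2"
proof -
  \<comment> \<open>Twice the smallest eigenvalue. Unlike for the determinant, every zero of it lies on the
    boundary of the positive semidefinite cone.\<close>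
  define m where
    "m \<tau> = (u + \<tau> * p) + (v + \<tau> * q) - sqrt (((u + \<tau> * p) - (v + \<tau> * q))\<^sup>2 + 4 * (\<tau> * r)\<^sup>2)"
    for \<tau>
  \<comment> \<open>The discriminant of the characteristic polynomial is the squared trace minus
    four determinants.\<close>
  have disc: "(a - b)\<^sup>2 + 4 * c\<^sup>2 = (a + b)\<^sup>2 - 4 * (a * b - c\<^sup>2)" for a b c :: real
    by (simp add: power2_eq_square algebra_simps)
  have "m T \<le> 0"
  proof -
    have "(u + T * p) + (v + T * q)
      \<le> sqrt (((u + T * p) - (v + T * q))\<^sup>2 + 4 * (T * r)\<^sup>2)"
      using T by (intro real_le_rsqrt) (simp add: disc)
    then show ?thesis
      by (simp add: m_def)
  qed
  moreover have "0 \<le> m 0"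
  proof -
    have "\<bar>u - v\<bar> \<le> u + v"
      using assms by auto
    then show ?thesis
      by (simp add: m_def)
  qed
  moreover have "continuous_on {0..T} m"
    unfolding m_def by (intro continuous_intros)
  ultimately obtain \<tau> where \<tau>: "0 \<le> \<tau>" "m \<tau> = 0"
    using IVT2'[of m T 0 0] \<open>0 \<le> T\<close> by auto
  let ?a = "u + \<tau> * p" and ?b = "v + \<tau> * q"
  have eq: "?a + ?b = sqrt ((?a - ?b)\<^sup>2 + 4 * (\<tau> * r)\<^sup>2)"
    using \<tau> by (simp add: m_def)
  then have "0 \<le> ?a + ?b"
    by simp
  have "(?a + ?b)\<^sup>2 = (?a - ?b)\<^sup>2 + 4 * (\<tau> * r)\<^sup>2"
    unfolding eq by simp
  then have det: "?a * ?b = (\<tau> * r)\<^sup>2"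
    unfolding disc by simp
  then have "0 \<le> ?a * ?b"
    by simp
  with \<open>0 \<le> ?a + ?b\<close> have "0 \<le> ?a" "0 \<le> ?b"
    by (auto simp: zero_le_mult_iff)
  with \<tau> det that show thesis
    by blast
qed

text \<open>Along the ray the determinant is quadratic in \<open>T\<close> with leading coefficient
  \<open>p * q - r\<^sup>2\<close>, hence eventually negative.\<close>

lemma indefinite_direction_exits:
  fixes u v p q r :: real
  assumes "0 < u" "0 < v" "p * q < r\<^sup>2"
  obtains T where "0 \<le> T" "(u + T * p) * (v + T * q) \<le> (T * r)\<^sup>2"
proof
  define c where "c = u * q + v * p"
  define D where "D = r\<^sup>2 - p * q"
  \<comment> \<open>The summand 1 yields \<open>1 \<le> T\<close>, which lets \<open>u * v\<close>
    be absorbed into \<open>T * (u * v)\<close>; the quotient bounds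
    \<open>u * v + \<bar>c\<bar>\<close> by \<open>D * T\<close>.\<close>
  define T where "T = (u * v + \<bar>c\<bar>) / D + 1"
  have "0 < D"
    using assms by (simp add: D_def)
  have T1: "1 \<le> T"
    using assms \<open>0 < D\<close> by (simp add: T_def)
  then show "0 \<le> T"
    by simp
  have "u * v + T * c \<le> T * (u * v) + T * \<bar>c\<bar>"
    using T1 assms by (intro add_mono mult_left_mono) auto
  also have "\<dots> = T * (u * v + \<bar>c\<bar>)"
    by (simp add: algebra_simps)
  also have "\<dots> \<le> T * (D * T)"
    using T1 \<open>0 < D\<close> by (intro mult_left_mono) (auto simp: T_def field_simps)
  finally show "(u + T * p) * (v + T * q) \<le> (T * r)\<^sup>2"
    by (simp add: c_def D_def algebra_simps power2_eq_square)
qed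

text \<open>A decreasing diagonal entry is followed until it vanishes, which makes the left-hand
  product zero.\<close>

lemma nonpositive_direction_exits:
  fixes u v p q r :: real
  assumes "0 < u" "0 < v" "p \<le> 0" "q \<le> 0" "p < 0 \<or> q < 0"
  obtains T where "0 \<le> T" "(u + T * p) * (v + T * q) \<le> (T * r)\<^sup>2"
proof (cases "p < 0")
  case True
  with assms show thesis
    by (intro that[of "u / - p"]) (auto simp: divide_nonneg_neg)
next
  case False
  with assms show thesis
    by (intro that[of "v / - q"]) (auto simp: divide_nonneg_neg)
qed

lemma binary_forms_convex_combination:
  fixes a1 b1 c1 a2 b2 c2 \<alpha> \<beta> \<gamma> u v :: real
  assumes form: "\<And>s t. 0 \<le> \<alpha> * s\<^sup>2 + 2 * \<beta> * (s * t) + \<gamma> * t\<^sup>2"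
    and uv: "0 < u" "0 < v"
  obtains s t where "a1 * s\<^sup>2 + 2 * b1 * (s * t) + c1 * t\<^sup>2 = u * a1 + v * c1"
    and "a2 * s\<^sup>2 + 2 * b2 * (s * t) + c2 * t\<^sup>2 = u * a2 + v * c2"
    and "\<alpha> * s\<^sup>2 + 2 * \<beta> * (s * t) + \<gamma> * t\<^sup>2 \<le> u * \<alpha> + v * \<gamma>"
proof -
  obtain p r q where nz: "(p, r, q) \<noteq> (0, 0, 0)"
    and k1: "a1 * p + 2 * b1 * r + c1 * q = 0" and k2: "a2 * p + 2 * b2 * r + c2 * q = 0"
    by (rule common_kernel_direction)
  \<comment> \<open>An indefinite direction leaves the cone both ways, so the sign is free to make
    the pairing nonpositive. Otherwise the direction is semidefinite and is oriented to be negative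
    semidefinite; self-duality then controls the pairing.\<close>
  define \<epsilon> :: real where
    "\<epsilon> = (if p * q < r\<^sup>2 then (if \<alpha> * p + 2 * \<beta> * r + \<gamma> * q \<le> 0 then 1 else - 1)
          else (if p \<le> 0 \<and> q \<le> 0 then 1 else - 1))"
  define p' r' q' where "p' = \<epsilon> * p" and "r' = \<epsilon> * r" and "q' = \<epsilon> * q"
  note defs = p'_def r'_def q'_def
  have \<epsilon>: "\<epsilon> = 1 \<or> \<epsilon> = - 1"
    by (simp add: \<epsilon>_def)
  have k1': "a1 * p' + 2 * b1 * r' + c1 * q' = 0" and k2': "a2 * p' + 2 * b2 * r' + c2 * q' = 0"
    using k1 k2 \<epsilon> by (auto simp: defs)
  have "\<alpha> * p' + 2 * \<beta> * r' + \<gamma> * q' \<le> 0 \<and>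
    (\<exists>T\<ge>0. (u + T * p') * (v + T * q') \<le> (T * r')\<^sup>2)"
  proof (cases "p * q < r\<^sup>2")
    case True
    then have "p' * q' < r'\<^sup>2"
      using \<epsilon> by (auto simp: defs)
    moreover have "\<alpha> * p' + 2 * \<beta> * r' + \<gamma> * q' \<le> 0"
      using True by (auto simp: defs \<epsilon>_def)
    ultimately show ?thesis
      using indefinite_direction_exits[OF uv] by metis
  next
    case False
    then have det: "r\<^sup>2 \<le> p * q"
      by simp
    then have "0 \<le> p * q"
      by (meson order_trans zero_le_power2)
    then have neg: "p' \<le> 0" "q' \<le> 0"
      using False by (auto simp: defs \<epsilon>_def zero_le_mult_iff)
    have "p \<noteq> 0 \<or> q \<noteq> 0"
      using nz det by auto
    then have "p' < 0 \<or> q' < 0"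
      using neg \<epsilon> by (auto simp: defs)
    moreover have "\<alpha> * p' + 2 * \<beta> * r' + \<gamma> * q' \<le> 0"
    proof -
      have "0 \<le> \<alpha> * (- p') + 2 * \<beta> * (- r') + \<gamma> * (- q')"
        using neg det \<epsilon> by (intro psd_pairing_nonneg[OF form]) (auto simp: defs)
      then show ?thesis
        by simp
    qed
    ultimately show ?thesis
      using nonpositive_direction_exits[OF uv neg] by metis
  qed
  then obtain T where le: "\<alpha> * p' + 2 * \<beta> * r' + \<gamma> * q' \<le> 0"
    and "0 \<le> T" "(u + T * p') * (v + T * q') \<le> (T * r')\<^sup>2"
    by blast
  then obtain \<tau> where \<tau>: "0 \<le> \<tau>" "0 \<le> u + \<tau> * p'" "0 \<le> v + \<tau> * q'"
    "(u + \<tau> * p') * (v + \<tau> * q') = (\<tau> * r')\<^sup>2"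
    using segment_reaches_psd_boundary[OF uv] by metis
  then obtain s t where st: "s\<^sup>2 = u + \<tau> * p'" "t\<^sup>2 = v + \<tau> * q'" "s * t = \<tau> * r'"
    using rank_one_factorization by metis
  \<comment> \<open>The rank-one matrix of \<open>(s, t)\<close> is diag(u, v) plus \<tau> times the
    direction, so each functional changes by \<tau> times its value there.\<close>
  have expand: "a * s\<^sup>2 + 2 * b * (s * t) + c * t\<^sup>2
      = u * a + v * c + \<tau> * (a * p' + 2 * b * r' + c * q')" for a b c
    unfolding st by (simp add: algebra_simps)
  show thesis
    using k1' k2' le \<tau>(1) by (intro that[of s t]) (auto simp: expand mult_nonneg_nonpos)
qed

section \<open>Transfer from binary forms to forms in n variables\<close>

lemma symmetric_matrix_inner_commute:
  fixes M :: "real ^ 'n ^ 'n"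
  assumes "symmetric_matrix M"
  shows "y \<bullet> (M *v x) = x \<bullet> (M *v y)"
proof -
  have "y v* M = M *v y"
    using assms transpose_matrix_vector[of M y] by (simp add: symmetric_matrix_def)
  then show ?thesis
    using dot_lmul_matrix[of y M x] by (simp add: inner_commute)
qed

lemma quadratic_form_combination:
  fixes M :: "real ^ 'n ^ 'n"
  assumes "symmetric_matrix M"
  shows "(s *\<^sub>R x + t *\<^sub>R y) \<bullet> (M *v (s *\<^sub>R x + t *\<^sub>R y))
    = (x \<bullet> (M *v x)) * s\<^sup>2 + 2 * (x \<bullet> (M *v y)) * (s * t) + (y \<bullet> (M *v y)) * t\<^sup>2"
  using symmetric_matrix_inner_commute[OF assms, of y x]
  by (simp add: matrix_vector_right_distrib matrix_vector_mult_scaleR inner_add_left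
      inner_add_right algebra_simps power2_eq_square)

text \<open>Geometrically, the joint range of the two forms, with all heights above the value of
  \<open>B\<close> added, is convex. In coordinates on the span of \<open>x\<close> and
  \<open>y\<close> the three forms are binary.\<close>

lemma quadratic_forms_convex_combination:
  fixes A1 A2 B :: "real ^ 'n ^ 'n"
  assumes sym: "symmetric_matrix A1" "symmetric_matrix A2" and psd: "psd_matrix B"
    and uv: "0 < u" "0 < v"
  obtains z where "z \<bullet> (A1 *v z) = u * (x \<bullet> (A1 *v x)) + v * (y \<bullet> (A1 *v y))"
    and "z \<bullet> (A2 *v z) = u * (x \<bullet> (A2 *v x)) + v * (y \<bullet> (A2 *v y))"
    and "z \<bullet> (B *v z) \<le> u * (x \<bullet> (B *v x)) + v * (y \<bullet> (B *v y))"
proof -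
  have symB: "symmetric_matrix B"
    using psd by (simp add: psd_matrix_def)
  have "0 \<le> (x \<bullet> (B *v x)) * s\<^sup>2 + 2 * (x \<bullet> (B *v y)) * (s * t) + (y \<bullet> (B *v y)) * t\<^sup>2" for s t
    using psd by (simp add: psd_matrix_def flip: quadratic_form_combination[OF symB])
  from binary_forms_convex_combination[OF this uv] obtain s t where
    "(x \<bullet> (A1 *v x)) * s\<^sup>2 + 2 * (x \<bullet> (A1 *v y)) * (s * t) + (y \<bullet> (A1 *v y)) * t\<^sup>2
      = u * (x \<bullet> (A1 *v x)) + v * (y \<bullet> (A1 *v y))"
    "(x \<bullet> (A2 *v x)) * s\<^sup>2 + 2 * (x \<bullet> (A2 *v y)) * (s * t) + (y \<bullet> (A2 *v y)) * t\<^sup>2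
      = u * (x \<bullet> (A2 *v x)) + v * (y \<bullet> (A2 *v y))"
    "(x \<bullet> (B *v x)) * s\<^sup>2 + 2 * (x \<bullet> (B *v y)) * (s * t) + (y \<bullet> (B *v y)) * t\<^sup>2
      \<le> u * (x \<bullet> (B *v x)) + v * (y \<bullet> (B *v y))"
    by blast
  then show thesis
    using that[of "s *\<^sub>R x + t *\<^sub>R y"]
    by (simp only: quadratic_form_combination[OF sym(1)] quadratic_form_combination[OF sym(2)]
        quadratic_form_combination[OF symB])
qed

section \<open>The lower envelope in the extended reals\<close>

lemma lower_envelope_le:
  assumes "(x \<bullet> (fst A *v x), x \<bullet> (snd A *v x)) = a"
  shows "lower_envelope A B a \<le> ereal (x \<bullet> (B *v x))"
  unfolding lower_envelope_def using assms by (intro Inf_lower) blast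

lemma lower_envelope_less_witness:
  assumes "lower_envelope A B a < ereal c"
  obtains x where "(x \<bullet> (fst A *v x), x \<bullet> (snd A *v x)) = a" "x \<bullet> (B *v x) < c"
  using assms unfolding lower_envelope_def Inf_less_iff by auto

lemma lower_envelope_nonneg:
  assumes "psd_matrix B"
  shows "0 \<le> lower_envelope A B a"
  unfolding lower_envelope_def using assms by (intro Inf_greatest) (auto simp: psd_matrix_def)

lemma ereal_convex_lower_envelope:
  fixes A :: "(real ^ 'n ^ 'n) \<times> (real ^ 'n ^ 'n)" and B :: "real ^ 'n ^ 'n"
  assumes sym: "symmetric_matrix (fst A)" "symmetric_matrix (snd A)" and psd: "psd_matrix B"
  shows "ereal_convex (lower_envelope A B)"
  unfolding ereal_convex_def
proof (intro allI impI)
  fix a b :: "real \<times> real" and u v :: real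
  assume uv: "0 < u" "0 < v" "u + v = 1"
  let ?V = "lower_envelope A B"
  have nonneg: "0 \<le> ?V c" for c
    by (rule lower_envelope_nonneg[OF psd])
  show "?V (u *\<^sub>R a + v *\<^sub>R b) \<le> ereal u * ?V a + ereal v * ?V b"
  proof (cases "?V a = \<infinity> \<or> ?V b = \<infinity>")
    case True
    with uv show ?thesis
      by auto
  next
    case False
    with nonneg obtain c d where cd: "?V a = ereal c" "?V b = ereal d"
      by (metis ereal_cases not_MInfty_nonneg)
    \<comment> \<open>The infimum need not be attained, so witnesses are taken within
      \<open>e\<close> of it; \<open>u + v = 1\<close> keeps the total slack equal to
      \<open>e\<close>.\<close>
    have "?V (u *\<^sub>R a + v *\<^sub>R b) \<le> ereal (u * c + v * d) + ereal e" if "0 < e" for e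
    proof -
      have "?V a < ereal (c + e)" "?V b < ereal (d + e)"
        using cd that by auto
      then obtain x y where x: "(x \<bullet> (fst A *v x), x \<bullet> (snd A *v x)) = a" "x \<bullet> (B *v x) < c + e"
        and y: "(y \<bullet> (fst A *v y), y \<bullet> (snd A *v y)) = b" "y \<bullet> (B *v y) < d + e"
        by (meson lower_envelope_less_witness)
      obtain z where z: "z \<bullet> (fst A *v z) = u * (x \<bullet> (fst A *v x)) + v * (y \<bullet> (fst A *v y))"
        "z \<bullet> (snd A *v z) = u * (x \<bullet> (snd A *v x)) + v * (y \<bullet> (snd A *v y))"
        "z \<bullet> (B *v z) \<le> u * (x \<bullet> (B *v x)) + v * (y \<bullet> (B *v y))"
        by (rule quadratic_forms_convex_combination[OF sym psd uv(1,2)])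
      have "?V (u *\<^sub>R a + v *\<^sub>R b) \<le> ereal (z \<bullet> (B *v z))"
        using x(1) y(1) z(1,2) by (intro lower_envelope_le) auto
      also have "z \<bullet> (B *v z) \<le> u * (c + e) + v * (d + e)"
        using z(3) x(2) y(2) uv
        by (elim order_trans) (intro add_mono mult_left_mono, auto)
      also have "\<dots> = u * c + v * d + (u + v) * e"
        by (simp add: algebra_simps)
      finally show ?thesis
        using uv by simp
    qed
    then have "?V (u *\<^sub>R a + v *\<^sub>R b) \<le> ereal (u * c + v * d)"
      by (rule ereal_le_epsilon2)
    then show ?thesis
      by (simp add: cd)
  qed
qed

text \<open>The first conjunct expresses that the codomain is the reals with only positive infinity
  added.\<close>

theorem proposition3p2:
  fixes A :: "(real ^ 'n ^ 'n) \<times> (real ^ 'n ^ 'n)" and B :: "real ^ 'n ^ 'n"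
  assumes "symmetric_matrix (fst A)" and "symmetric_matrix (snd A)"
    and "psd_matrix B"
  shows "(\<forall>a. lower_envelope A B a \<noteq> -\<infinity>) \<and> ereal_convex (lower_envelope A B)"
  using ereal_convex_lower_envelope[OF assms] lower_envelope_nonneg[OF assms(3), of A]
  by auto

end
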